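(* Let $\mathbf r\in\mathcal R$ and $U_{\mathbf r}(t)=g_1g_2g_3$ with $g_\nu=r_\nu(\sigma_3t+\ell)+1$ ($\nu=1,2,3$). Then for all integers $t\ge0$ and $\nu=1,2,3$ we have $U_{\mathbf r}(t)=P^{h_\nu}_{g_\nu}$ with $h_\nu=2(c_\nu+d_\nu t)$, where $c_\nu=\sigma_1/r_\nu+\ell\sigma_3/r_\nu^2$ and $d_\nu=(\sigma_3/r_\nu)^2$ are positive integers with $c_\nu\ge2$ and $d_\nu\ge4$. In particular $h_\nu\ge4$ if $t=0$ and $h_\nu\ge12$ if $t\ge1$.
   Context: For integers $h\ge1$ and $n\ge1$, the $h$-gonal number is $P^h_n=\frac12\bigl(n^2(h-2)-n(h-4)\bigr)$. $\mathcal R$ is the set of triples $\mathbf r=(r_1,r_2,r_3)$ of pairwise coprime positive integers with $r_1<r_2<r_3$; for such $\mathbf r$, $\sigma_1=r_1+r_2+r_3$, $\sigma_2=r_1r_2+r_1r_3+r_2r_3$, $\sigma_3=r_1r_2r_3$, $\ell$ is the unique integer with $0\le\ell<\sigma_3$ and $\ell\sigma_2\equiv-\sigma_1\pmod{\sigma_3}$, and $U_{\mathbf r}(t)=\prod_{\nu=1}^3(r_\nu(\sigma_3t+\ell)+1)$. *)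

theory Defs
  imports "HOL-Analysis.Cartesian_Space" "HOL-Number_Theory.Cong"
begin

text \<open>
  The \<open>h\<close>-gonal number \<open>P\<^sup>h\<^sub>n\<close>, meant for \<open>h \<ge> 1\<close> and \<open>n \<ge> 1\<close>. It is rational-valued
  so that the factor one half is genuine division.
\<close>
definition polygonal :: "int \<Rightarrow> int \<Rightarrow> rat" where
  "polygonal h n = 1 / 2 * of_int (n\<^sup>2 * (h - 2) - n * (h - 4))"

text \<open>
  A triple of integers is a vector \<open>r :: int ^ 3\<close> with components \<open>r $ 1\<close>, \<open>r $ 2\<close>, \<open>r $ 3\<close>.
  The index type \<open>3\<close> has exactly the elements 1, 2, 3 (with \<open>3 = 0\<close>), so a variable
  \<open>\<nu> :: 3\<close> ranges over exactly these indices.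
\<close>
definition triples :: "(int ^ 3) set" where
  "triples = {r. 0 < r $ 1 \<and> r $ 1 < r $ 2 \<and> r $ 2 < r $ 3 \<and>
     coprime (r $ 1) (r $ 2) \<and> coprime (r $ 1) (r $ 3) \<and> coprime (r $ 2) (r $ 3)}"

definition sigma1 :: "int ^ 3 \<Rightarrow> int" where
  "sigma1 r = r $ 1 + r $ 2 + r $ 3"

definition sigma2 :: "int ^ 3 \<Rightarrow> int" where
  "sigma2 r = r $ 1 * r $ 2 + r $ 1 * r $ 3 + r $ 2 * r $ 3"

definition sigma3 :: "int ^ 3 \<Rightarrow> int" where
  "sigma3 r = r $ 1 * r $ 2 * r $ 3"

definition ell :: "int ^ 3 \<Rightarrow> int" where
  "ell r = (THE l. 0 \<le> l \<and> l < sigma3 r \<and> [l * sigma2 r = - sigma1 r] (mod sigma3 r))"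

definition g :: "int ^ 3 \<Rightarrow> 3 \<Rightarrow> int \<Rightarrow> int" where
  "g r \<nu> t = r $ \<nu> * (sigma3 r * t + ell r) + 1"

definition U :: "int ^ 3 \<Rightarrow> int \<Rightarrow> int" where
  "U r t = (\<Prod>\<nu>\<in>UNIV. g r \<nu> t)"

text \<open>
  The coefficients \<open>c\<^sub>\<nu>\<close> and \<open>d\<^sub>\<nu>\<close> are given by formulas with genuine division, hence are a priori
  only rational.
\<close>
definition c_coeff :: "int ^ 3 \<Rightarrow> 3 \<Rightarrow> rat" where
  "c_coeff r \<nu> = of_int (sigma1 r) / of_int (r $ \<nu>)
     + of_int (ell r) * of_int (sigma3 r) / (of_int (r $ \<nu>))\<^sup>2"

definition d_coeff :: "int ^ 3 \<Rightarrow> 3 \<Rightarrow> rat" where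
  "d_coeff r \<nu> = (of_int (sigma3 r) / of_int (r $ \<nu>))\<^sup>2"

text \<open>The definite description in \<open>ell\<close> is well defined on \<open>triples\<close>.\<close>
lemma ell_ex1:
  assumes "r \<in> triples"
  shows "\<exists>!l. 0 \<le> l \<and> l < sigma3 r \<and> [l * sigma2 r = - sigma1 r] (mod sigma3 r)"
proof -
  have pos: "sigma3 r > 0"
    using assms by (auto simp: triples_def sigma3_def)
  have cop: "coprime (r $ 1) (r $ 2)" "coprime (r $ 1) (r $ 3)" "coprime (r $ 2) (r $ 3)"
    using assms by (auto simp: triples_def)
  have aux: "coprime (a * b + c) a" if "coprime c a" for a b c :: int
  proof (rule coprimeI)
    fix k assume "k dvd a * b + c" "k dvd a"
    then have "k dvd c"
      by (metis dvd_add_right_iff dvd_mult2)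
    with \<open>k dvd a\<close> that show "is_unit k"
      using coprime_common_divisor by blast
  qed
  have "coprime (r $ 1 * (r $ 2 + r $ 3) + r $ 2 * r $ 3) (r $ 1)"
    using cop by (intro aux) (simp add: coprime_commute)
  moreover have "coprime (r $ 2 * (r $ 1 + r $ 3) + r $ 1 * r $ 3) (r $ 2)"
    using cop by (intro aux) (simp add: coprime_commute)
  moreover have "coprime (r $ 3 * (r $ 1 + r $ 2) + r $ 1 * r $ 2) (r $ 3)"
    using cop by (intro aux) (simp add: coprime_commute)
  ultimately have co: "coprime (sigma2 r) (sigma3 r)"
    by (simp add: sigma2_def sigma3_def algebra_simps)
  obtain x where x: "[sigma2 r * x = 1] (mod sigma3 r)"
    using co cong_solve_coprime_int by blast
  define l where "l = (- sigma1 r * x) mod sigma3 r"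
  have "[l * sigma2 r = (- sigma1 r * x) * sigma2 r] (mod sigma3 r)"
    unfolding l_def by (intro cong_scalar_right) simp
  also have "(- sigma1 r * x) * sigma2 r = - sigma1 r * (sigma2 r * x)"
    by simp
  also have "[\<dots> = - sigma1 r * 1] (mod sigma3 r)"
    using x by (rule cong_scalar_left)
  finally have "[l * sigma2 r = - sigma1 r] (mod sigma3 r)"
    by simp
  moreover have "0 \<le> l" "l < sigma3 r"
    using pos by (auto simp: l_def)
  moreover have "m = k" if "0 \<le> m" "m < sigma3 r" "[m * sigma2 r = - sigma1 r] (mod sigma3 r)"
    "0 \<le> k" "k < sigma3 r" "[k * sigma2 r = - sigma1 r] (mod sigma3 r)" for m k
    by (metis co that cong_mult_rcancel cong_less_imp_eq_int cong_sym cong_trans)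
  ultimately show ?thesis
    by blast
qed

end

theory Submission
  imports Defs
begin

text \<open>
  Write \<open>x = r\<^sub>\<nu>\<close>, let \<open>y\<close>, \<open>z\<close> be the other two entries, and put \<open>m = \<sigma>\<^sub>3 t + \<ell>\<close>. Reducing
  \<open>\<ell> \<sigma>\<^sub>2 + \<sigma>\<^sub>1 \<equiv> 0\<close> modulo \<open>x\<close> gives \<open>x dvd y + z + \<ell> y z\<close>, which is the integrality of \<open>c\<^sub>\<nu>\<close>.
  For \<open>h = 2k\<close> the polygonal number \<open>P\<^sup>h\<^sub>n\<close> equals \<open>n ((n - 1) (k - 1) + 1)\<close>, and with
  \<open>n = x m + 1\<close>, \<open>k = c\<^sub>\<nu> + d\<^sub>\<nu> t\<close> one has \<open>x (k - 1) = y + z + y z m\<close>, so that the second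
  factor is \<open>(y m + 1) (z m + 1)\<close>.
\<close>

lemma polygonal_even: "polygonal (2 * k) n = of_int (n * ((n - 1) * (k - 1) + 1))"
  by (simp add: polygonal_def power2_eq_square algebra_simps)

lemma dvd_sum_add_prod:
  fixes x y z l :: int
  assumes "[l * (x * y + x * z + y * z) = - (x + y + z)] (mod (x * y * z))"
  shows "x dvd y + z + l * y * z"
proof -
  have "x * (y * z) dvd l * (x * y + x * z + y * z) + (x + y + z)"
    using assms by (simp only: cong_iff_dvd_diff mult.assoc diff_minus_eq_add)
  then have "x dvd l * (x * y + x * z + y * z) + (x + y + z)"
    by (rule dvd_mult_left)
  also have "\<dots> = (y + z + l * y * z) + x * (l * (y + z) + 1)"
    by (simp add: algebra_simps)
  finally show ?thesis
    by (simp only: dvd_add_left_iff dvd_triv_left)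
qed

text \<open>The hypothesis on \<open>c\<close> is the formula for c_\<nu> cleared of denominators,
  with \<open>x\<close> as r_\<nu> and \<sigma>_3 / \<open>x\<close> = \<open>y * z\<close>.\<close>

lemma prod_eq_polygonal:
  fixes x y z l c t m :: int
  assumes c: "x * c = x + y + z + l * y * z"
    and m: "m = x * y * z * t + l"
  shows "of_int ((x * m + 1) * (y * m + 1) * (z * m + 1)) =
    polygonal (2 * (c + (y * z)\<^sup>2 * t)) (x * m + 1)"
proof -
  define k where "k = c + (y * z)\<^sup>2 * t"
  have "x * (k - 1) = x * c + x * (y * z)\<^sup>2 * t - x"
    by (simp add: k_def algebra_simps)
  \<comment> \<open>Since \<open>x * y * z * t = m - l\<close>, the quadratic term is
    \<open>y * z * (m - l)\<close>; its part in \<open>l\<close> cancels the one in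
    \<open>x * c\<close>.\<close>
  also have "\<dots> = y + z + y * z * m"
    unfolding c m by (simp add: power2_eq_square algebra_simps)
  finally have k: "x * (k - 1) = y + z + y * z * m" .
  have "(x * m + 1 - 1) * (k - 1) + 1 = m * (x * (k - 1)) + 1"
    by simp
  also have "\<dots> = (y * m + 1) * (z * m + 1)"
    unfolding k by (simp add: algebra_simps)
  finally show ?thesis
    by (simp only: polygonal_even mult.assoc flip: k_def)
qed

text \<open>The distinguished entry is \<open>x\<close>, and no order among the entries is assumed,
  so that one argument serves all three indices. Keeping \<open>s1\<close> and \<open>s3\<close> as
  variables lets the conclusion match each case, whatever the order of the entries.\<close>

lemma polygonal_representation:
  fixes x y z l s1 s3 :: int
  assumes pos: "x > 0" "y > 0" "z > 0" and "y \<noteq> z" and "l \<ge> 0"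
    and cong: "[l * (x * y + x * z + y * z) = - (x + y + z)] (mod (x * y * z))"
    and s1: "s1 = x + y + z" and s3: "s3 = x * y * z"
  shows "\<exists>c d :: int.
      of_int c = (of_int s1 / of_int x + of_int l * of_int s3 / (of_int x)\<^sup>2 :: rat) \<and>
      of_int d = ((of_int s3 / of_int x)\<^sup>2 :: rat) \<and>
      c > 0 \<and> d > 0 \<and> c \<ge> 2 \<and> d \<ge> 4 \<and>
      (\<forall>t::int. t \<ge> 0 \<longrightarrow>
        (let h = 2 * (c + d * t) in
          of_int ((x * (s3 * t + l) + 1) * (y * (s3 * t + l) + 1) * (z * (s3 * t + l) + 1)) =
            polygonal h (x * (s3 * t + l) + 1) \<and>
          (t = 0 \<longrightarrow> h \<ge> 4) \<and>
          (t \<ge> 1 \<longrightarrow> h \<ge> 12)))"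
proof -
  obtain b where b: "y + z + l * y * z = x * b"
    using dvd_sum_add_prod[OF cong] by (elim dvdE)
  \<comment> \<open>The summand \<open>x\<close> of \<open>s1\<close> contributes 1 to c_\<nu>, and
    \<open>b\<close> is the rest. As \<open>b\<close> is a positive integer,
    \<open>c \<ge> 2\<close>.\<close>
  define c where "c = b + 1"
  define d where "d = (y * z)\<^sup>2"
  have xc: "x * c = x + y + z + l * y * z"
    using b by (simp add: c_def algebra_simps)
  have "l * y * z \<ge> 0"
    using pos \<open>l \<ge> 0\<close> by simp
  then have "x * b > 0"
    using b pos by linarith
  then have c2: "c \<ge> 2"
    using \<open>x > 0\<close> by (simp add: c_def zero_less_mult_iff)
  \<comment> \<open>A product 1 would force \<open>y = z = 1\<close>; distinctness thus yields
    \<open>d \<ge> 2\<^sup>2\<close>.\<close>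
  have "y * z \<noteq> 1"
    using pos \<open>y \<noteq> z\<close> by (auto simp: zmult_eq_1_iff)
  moreover have "y * z > 0"
    using pos by simp
  ultimately have "y * z \<ge> 2"
    by linarith
  then have d4: "d \<ge> 4"
    using power_mono[of 2 "y * z" 2] by (simp add: d_def)
  have x0: "(of_int x :: rat) \<noteq> 0"
    using \<open>x > 0\<close> by simp
  have "(of_int x * of_int c :: rat) = of_int (x + y + z + l * y * z)"
    unfolding xc[symmetric] by simp
  then have "of_int c = (of_int (x + y + z + l * y * z) / of_int x :: rat)"
    using x0 by (metis nonzero_mult_div_cancel_left)
  also have "\<dots> = of_int s1 / of_int x + of_int l * of_int s3 / (of_int x)\<^sup>2"
    using x0 by (simp add: s1 s3 add_divide_distrib power2_eq_square)
  finally have c_eq: "of_int c = (of_int s1 / of_int x + of_int l * of_int s3 / (of_int x)\<^sup>2 :: rat)" .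
  have d_eq: "of_int d = ((of_int s3 / of_int x)\<^sup>2 :: rat)"
    using x0 by (simp add: s3 d_def)
  have h12: "2 * (c + d * t) \<ge> 12" if "t \<ge> 1" for t
    using mult_mono[of 4 d 1 t] c2 d4 that by simp
  have rep: "of_int ((x * (s3 * t + l) + 1) * (y * (s3 * t + l) + 1) * (z * (s3 * t + l) + 1)) =
      polygonal (2 * (c + d * t)) (x * (s3 * t + l) + 1)" for t
    unfolding d_def by (rule prod_eq_polygonal[OF xc]) (simp add: s3)
  show ?thesis
    unfolding Let_def
  proof (rule exI[of _ c], rule exI[of _ d], intro conjI allI impI)
  qed (use c2 d4 in \<open>simp_all only: c_eq[symmetric] d_eq[symmetric] rep h12, simp_all\<close>)
qed

theorem theorem10p1:
  fixes r :: "int ^ 3"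
  assumes "r \<in> triples"
  shows "\<forall>\<nu>::3. \<exists>c d :: int.
      of_int c = c_coeff r \<nu> \<and> of_int d = d_coeff r \<nu> \<and>
      c > 0 \<and> d > 0 \<and> c \<ge> 2 \<and> d \<ge> 4 \<and>
      (\<forall>t::int. t \<ge> 0 \<longrightarrow>
        (let h = 2 * (c + d * t) in
          of_int (U r t) = polygonal h (g r \<nu> t) \<and>
          (t = 0 \<longrightarrow> h \<ge> 4) \<and>
          (t \<ge> 1 \<longrightarrow> h \<ge> 12)))"
proof -
  have l: "0 \<le> ell r" "[ell r * sigma2 r = - sigma1 r] (mod sigma3 r)"
    using theI'[OF ell_ex1[OF assms]] by (auto simp: ell_def)
  have pos: "r $ 1 > 0" "r $ 2 > 0" "r $ 3 > 0"
    and ne: "r $ 1 \<noteq> r $ 2" "r $ 1 \<noteq> r $ 3" "r $ 2 \<noteq> r $ 3"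
    using assms by (auto simp: triples_def)
  have U: "U r t = g r 1 t * g r 2 t * g r 3 t" for t
    unfolding U_def UNIV_3 by simp
  \<comment> \<open>Each version puts the factor that becomes the index of the polygonal number
    first.\<close>
  have U1: "U r t = g r 1 t * g r 2 t * g r 3 t"
    and U2: "U r t = g r 2 t * g r 1 t * g r 3 t"
    and U3: "U r t = g r 3 t * g r 1 t * g r 2 t" for t
    by (simp_all only: U mult_ac)
  note cong = l(2)[unfolded sigma1_def sigma2_def sigma3_def]
  show ?thesis
    unfolding forall_3 c_coeff_def d_coeff_def
  proof (intro conjI, goal_cases)
    case 1
    show ?case
      unfolding U1 g_def
      by (rule polygonal_representation[OF pos(1,2,3) ne(3) l(1)])
        (use cong in \<open>simp_all add: sigma1_def sigma3_def ac_simps\<close>)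
  next
    case 2
    show ?case
      unfolding U2 g_def
      by (rule polygonal_representation[OF pos(2,1,3) ne(2) l(1)])
        (use cong in \<open>simp_all add: sigma1_def sigma3_def ac_simps\<close>)
  next
    case 3
    show ?case
      unfolding U3 g_def
      by (rule polygonal_representation[OF pos(3,1,2) ne(1) l(1)])
        (use cong in \<open>simp_all add: sigma1_def sigma3_def ac_simps\<close>)
  qed
qed

end
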